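(* Let $(X_t)$ be a Markov decision process with countable state set $\mathcal{X}$ and countable action set $\mathcal{U}$, let $\pi=(\pi_{iu})$ be a fixed stationary policy and let $\rho:\mathcal{U}\times\mathcal{X}\to\mathbb{R}$ be a reward. Let $E\subset\mathcal{X}$ be a target set and $H:=\mathcal{X}\setminus E$. Suppose that 1. the process $(X_t)$ with policy $\pi$ is transient on $H$, i.e. $\mathbb{P}_\pi[X_t\in H\text{ for infinitely many }t\mid X_0\in H]=0$; 2. $\rho(u,e)=0$ for all $u\in\mathcal{U}$ and all $e\in E$. Let $\tau:=\tau_E:=\min\{t\ge 0 : X_t\in E\}$ be the first hitting time of $E$, and let $R_\pi\in\mathbb{R}^H$ be given by $R_\pi(i)=\sum_{u\in\mathcal{U}}\pi_{iu}\,\rho(u,i)$ for $i\in H$. Then the cost function $V_\pi(i):=\mathbb{E}_\pi\left[\sum_{t=0}^{\tau}\rho(U_t,X_t)\,\middle|\,X_0=i\right]$ satisfies $$V_\pi|_H=G(\pi)R_\pi ,$$ where $G(\pi)$ is the Green kernel for the set $H$, and $V_\pi(e)=0$ for $e\in E$.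
   Context: A Markov decision process on the countable state set $\mathcal{X}$ with countable action set $\mathcal{U}$ is given by transition probabilities $p_{iuj}=\mathbb{P}[X_{t+1}=j\mid X_t=i,U_t=u]$, with $\sum_{j\in\mathcal{X}}p_{iuj}=1$, where the Markov property $\mathbb{P}[X_{t+1}=j\mid X_0,U_0,\dots,X_t,U_t]=\mathbb{P}[X_{t+1}=j\mid X_t,U_t]$ holds. A stationary policy is a matrix $\pi=(\pi_{iu})$ with $\pi_{iu}=\mathbb{P}[U_t=u\mid X_t=i]\ge 0$ and $\sum_{u}\pi_{iu}=1$ for each $i$; the actions $U_t$ are generated by $\pi$. $\mathbb{P}_\pi,\mathbb{E}_\pi$ denote the law and expectation under $\pi$. The induced Markov chain has transition matrix $P(\pi)=(p_{ij}(\pi))_{i,j\in\mathcal{X}}$ with $p_{ij}(\pi)=\sum_{u\in\mathcal{U}}\pi_{iu}p_{iuj}$. For the taboo set $H\subset\mathcal{X}$, $Q(\pi)=(p_{ij}(\pi))_{i,j\in H}$, and the Green kernel (occupation operator) is $G(\pi)=\sum_{k=0}^{\infty}Q(\pi)^k$. Functions on $H$ are regarded as column vectors, and $G(\pi)R_\pi$ is a matrix-vector product.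
   Formalization: For i in H the identity is proved when the expected total positive reward or the expected total negative reward up to τ is finite (values in [-∞,∞]); without such a condition it fails, e.g. for doubling the stake of a fair bet until the first win, where V=1 but GR=0. *)

theory Defs
  imports "HOL-Probability.Probability"
begin

text \<open>
  A kernel \<open>p i u\<close> is a probability mass function on states, so that \<open>pmf (p i u) j\<close> is \<open>p\<^sub>i\<^sub>u\<^sub>j\<close>;
  likewise \<open>pmf (\<pi> i) u\<close> is \<open>\<pi>\<^sub>i\<^sub>u\<close>.

  The law of \<open>X 0\<close> is arbitrary. As conditional probabilities are elementary, the two conditions
  are only required for histories of positive probability. The condition \<open>policy\<close> is the meaning of
  ``the actions are generated by \<open>\<pi>\<close>'': given the past, the next action is drawn from
  \<open>\<pi>\<close> at the current state. The condition \<open>transition\<close> comprises both the Markov property and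
  the fact that \<open>p\<close> is the transition probability, since the right hand side depends on the
  current state and action only.
\<close>

locale markov_decision_process = prob_space M
  for M :: "'w measure"
    and p :: "'x::countable \<Rightarrow> 'u::countable \<Rightarrow> 'x pmf"
    and \<pi> :: "'x \<Rightarrow> 'u pmf"
    and X :: "nat \<Rightarrow> 'w \<Rightarrow> 'x"
    and U :: "nat \<Rightarrow> 'w \<Rightarrow> 'u" +
  assumes measurable_X: "X t \<in> measurable M (count_space UNIV)"
    and measurable_U: "U t \<in> measurable M (count_space UNIV)"
    and policy:
      "\<P>(\<omega> in M. (\<forall>s\<le>t. X s \<omega> = x s) \<and> (\<forall>s<t. U s \<omega> = u s)) > 0 \<Longrightarrow>
       \<P>(\<omega> in M. U t \<omega> = a \<bar> (\<forall>s\<le>t. X s \<omega> = x s) \<and> (\<forall>s<t. U s \<omega> = u s)) = pmf (\<pi> (x t)) a"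
    and transition:
      "\<P>(\<omega> in M. \<forall>s\<le>t. X s \<omega> = x s \<and> U s \<omega> = u s) > 0 \<Longrightarrow>
       \<P>(\<omega> in M. X (Suc t) \<omega> = j \<bar> \<forall>s\<le>t. X s \<omega> = x s \<and> U s \<omega> = u s) = pmf (p (x t) (u t)) j"

definition transition_matrix ::
    "('x \<Rightarrow> 'u \<Rightarrow> 'x pmf) \<Rightarrow> ('x \<Rightarrow> 'u pmf) \<Rightarrow> 'x \<Rightarrow> 'x \<Rightarrow> real" where
  "transition_matrix p \<pi> i j = (\<Sum>\<^sub>\<infinity>u. pmf (\<pi> i) u * pmf (p i u) j)"

text \<open>
  Powers of the restriction of a matrix to the index set \<open>H\<close>. Only entries with both indices
  in \<open>H\<close> are meaningful.
\<close>

primrec restricted_power :: "'x set \<Rightarrow> ('x \<Rightarrow> 'x \<Rightarrow> real) \<Rightarrow> nat \<Rightarrow> 'x \<Rightarrow> 'x \<Rightarrow> real" where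
  "restricted_power H A 0 i j = (if i = j then 1 else 0)"
| "restricted_power H A (Suc k) i j = (\<Sum>\<^sub>\<infinity>l\<in>H. restricted_power H A k i l * A l j)"

text \<open>
  The entries of the Green kernel are sums of nonnegative terms and are formed in \<open>[0, \<infinity>]\<close>, so
  that no convergence has to be presupposed.
\<close>

definition green_kernel ::
    "('x \<Rightarrow> 'u \<Rightarrow> 'x pmf) \<Rightarrow> ('x \<Rightarrow> 'u pmf) \<Rightarrow> 'x set \<Rightarrow> 'x \<Rightarrow> 'x \<Rightarrow> ereal" where
  "green_kernel p \<pi> H i j = (\<Sum>k. ereal (restricted_power H (transition_matrix p \<pi>) k i j))"

definition hitting_time :: "(nat \<Rightarrow> 'w \<Rightarrow> 'x) \<Rightarrow> 'x set \<Rightarrow> 'w \<Rightarrow> enat" where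
  "hitting_time X E \<omega> = (INF t\<in>{t. X t \<omega> \<in> E}. enat t)"

text \<open>
  The Lebesgue integral with values in the extended reals. It is meaningful if the positive or the
  negative part has finite integral. For integrable real functions it is the library's integral,
  see \<open>ext_integral_eq_integral\<close> below.
\<close>

definition ext_integral :: "'a measure \<Rightarrow> ('a \<Rightarrow> ereal) \<Rightarrow> ereal" where
  "ext_integral M f =
     enn2ereal (\<integral>\<^sup>+x. e2ennreal (f x) \<partial>M) - enn2ereal (\<integral>\<^sup>+x. e2ennreal (- f x) \<partial>M)"

lemma ext_integral_eq_integral:
  fixes f :: "'a \<Rightarrow> real"
  assumes "integrable M f"
  shows "ext_integral M (\<lambda>x. ereal (f x)) = ereal (\<integral>x. f x \<partial>M)"
proof -
  have fin: "(\<integral>\<^sup>+x. ennreal (f x) \<partial>M) < \<infinity>" "(\<integral>\<^sup>+x. ennreal (- f x) \<partial>M) < \<infinity>"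
    using assms by (auto simp: real_integrable_def top.not_eq_extremum)
  have e: "enn2ereal a = ereal (enn2real a)" if "a < \<infinity>" for a
    using that by (cases a) auto
  show ?thesis
    using fin by (simp add: ext_integral_def real_lebesgue_integral_def[OF assms] e)
qed

text \<open>
  The expectation is taken conditionally on the event \<open>X 0 = i\<close>, which is meaningful if this event
  has positive probability. On paths that never hit \<open>E\<close> the inner sum has infinitely many terms.
\<close>

definition cost_function ::
    "'w measure \<Rightarrow> (nat \<Rightarrow> 'w \<Rightarrow> 'x) \<Rightarrow> (nat \<Rightarrow> 'w \<Rightarrow> 'u) \<Rightarrow> 'x set \<Rightarrow> ('u \<Rightarrow> 'x \<Rightarrow> real) \<Rightarrow> 'x \<Rightarrow> ereal"
  where
  "cost_function M X U E \<rho> i =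
     ext_integral (uniform_measure M {\<omega> \<in> space M. X 0 \<omega> = i})
       (\<lambda>\<omega>. ereal (\<Sum>\<^sub>\<infinity>t\<in>{t. enat t \<le> hitting_time X E \<omega>}. \<rho> (U t \<omega>) (X t \<omega>)))"

text \<open>
  The expectation defining the cost function exists in \<open>[-\<infinity>, \<infinity>]\<close>: the expected total positive
  rewards or the expected total negative rewards are finite. Integrability of the total reward alone
  would not suffice for an identity with the Green kernel: doubling the stake of a fair bet until
  the first win has total reward \<open>1\<close>, while the mean reward of every single step is \<open>0\<close>.
\<close>

definition cost_well_defined ::
    "'w measure \<Rightarrow> (nat \<Rightarrow> 'w \<Rightarrow> 'x) \<Rightarrow> (nat \<Rightarrow> 'w \<Rightarrow> 'u) \<Rightarrow> 'x set \<Rightarrow> ('u \<Rightarrow> 'x \<Rightarrow> real) \<Rightarrow> 'x \<Rightarrow> bool"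
  where
  "cost_well_defined M X U E \<rho> i \<longleftrightarrow>
     cost_function M X U E (\<lambda>u x. max 0 (\<rho> u x)) i < \<infinity> \<or>
     cost_function M X U E (\<lambda>u x. max 0 (- \<rho> u x)) i < \<infinity>"

definition policy_reward :: "('x \<Rightarrow> 'u pmf) \<Rightarrow> ('u \<Rightarrow> 'x \<Rightarrow> real) \<Rightarrow> 'x \<Rightarrow> real" where
  "policy_reward \<pi> \<rho> i = (\<Sum>\<^sub>\<infinity>u. pmf (\<pi> i) u * \<rho> u i)"

text \<open>
  The sum over \<open>H\<close> has terms of both signs and is the difference of the sum of its positive terms
  and the sum of the absolute values of its negative terms.
\<close>

definition matrix_vector :: "'x set \<Rightarrow> ('x \<Rightarrow> 'x \<Rightarrow> ereal) \<Rightarrow> ('x \<Rightarrow> real) \<Rightarrow> 'x \<Rightarrow> ereal" where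
  "matrix_vector H A v i = ext_integral (count_space H) (\<lambda>j. A i j * ereal (v j))"

end

theory Submission
  imports Defs
begin

text \<open>
  On \<open>X\<^sub>0 = i\<close>, the reward until the hitting time \<open>\<tau>\<close> of \<open>E\<close> is the sum over all \<open>t\<close> of \<open>\<rho>(U\<^sub>t, X\<^sub>t)\<close> on the
  event \<open>t < \<tau>\<close>, as the reward vanishes on \<open>E\<close>. The event \<open>t < \<tau>\<close> says that the path has not yet left
  \<open>H\<close>. The probability that this holds and that \<open>X\<^sub>t = j\<close> is the entry \<open>(i, j)\<close> of \<open>Q(\<pi>)\<^sup>t\<close>
  (\<open>prob_stay_eq_restricted_power\<close>), and given this event the action \<open>U\<^sub>t\<close> is drawn from \<open>\<pi>\<close> at \<open>j\<close>
  (\<open>policy_given_past\<close>). Summing over \<open>t\<close>, \<open>j\<close> and the actions yields \<open>G(\<pi>) R\<^sub>\<pi>\<close>.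

  The interchange of sums and expectation is justified by nonnegativity. It is therefore carried out
  for the positive part and the negative part of the reward separately
  (\<open>expected_positive_reward_before_exit\<close>), and the results are subtracted at the end. The subtraction
  has to be justified on both sides: for the expectation transience is used, which makes the sum up
  to \<open>\<tau>\<close> finite almost surely, and hence equal to the difference of its parts
  (\<open>cost_function_eq_diff\<close>); for the matrix-vector product the mean reward is the difference
  of the means of its parts (\<open>matrix_vector_eq_diff\<close>). Both follow from the same linearity
  property of the extended integral (\<open>ext_integral_diff\<close>), where only one of the two integrals
  has to be finite; this is what \<^const>\<open>cost_well_defined\<close> provides.
\<close>

section \<open>Differences of integrals\<close>

lemma ereal_diff_eq_diff:
  fixes a b c d :: ennreal
  assumes "a + d = b + c" "a \<le> c" "b \<le> d" "c < \<infinity> \<or> d < \<infinity>"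
  shows "enn2ereal a - enn2ereal b = enn2ereal c - enn2ereal d"
  using assms
  by (cases a; cases b; cases c; cases d)
     (auto simp: ennreal_plus[symmetric] top_unique simp del: ennreal_plus)

lemma e2ennreal_diff_add:
  fixes F G :: ennreal
  assumes "F < \<infinity> \<or> G < \<infinity>"
  shows "e2ennreal (enn2ereal F - enn2ereal G) + G = e2ennreal (- (enn2ereal F - enn2ereal G)) + F"
    and "e2ennreal (enn2ereal F - enn2ereal G) \<le> F"
    and "e2ennreal (- (enn2ereal F - enn2ereal G)) \<le> G"
proof -
  have *: "ennreal (a - b) + ennreal b = ennreal (b - a) + ennreal a" if "0 \<le> a" "0 \<le> b" for a b
    using that by (cases "a \<le> b") (auto simp: ennreal_plus[symmetric] ennreal_neg simp del: ennreal_plus)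
  show "e2ennreal (enn2ereal F - enn2ereal G) + G = e2ennreal (- (enn2ereal F - enn2ereal G)) + F"
    and "e2ennreal (enn2ereal F - enn2ereal G) \<le> F"
    and "e2ennreal (- (enn2ereal F - enn2ereal G)) \<le> G"
    using assms by (cases F; cases G; auto simp: * e2ennreal_neg intro!: ennreal_leI)+
qed

text \<open>
  The positive and negative part of \<open>F - G\<close> are in general smaller than \<open>F\<close> and \<open>G\<close>. Integrating
  the cancellation-free form \<open>(F - G)\<^sup>+ + G = (F - G)\<^sup>- + F\<close> and subtracting afterwards gives linearity
  also if one of the two integrals is infinite. If, say, \<open>F\<close> has a finite integral, then \<open>F\<close> is
  finite almost everywhere, so that the values of \<open>f\<close> where both functions are infinite do not matter.
\<close>

lemma ext_integral_diff:
  fixes f :: "'a \<Rightarrow> ereal" and F G :: "'a \<Rightarrow> ennreal"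
  assumes [measurable]: "F \<in> borel_measurable M" "G \<in> borel_measurable M"
    and f: "AE x in M. F x < \<infinity> \<or> G x < \<infinity> \<longrightarrow> f x = enn2ereal (F x) - enn2ereal (G x)"
    and fin: "(\<integral>\<^sup>+x. F x \<partial>M) < \<infinity> \<or> (\<integral>\<^sup>+x. G x \<partial>M) < \<infinity>"
  shows "ext_integral M f = enn2ereal (\<integral>\<^sup>+x. F x \<partial>M) - enn2ereal (\<integral>\<^sup>+x. G x \<partial>M)"
proof -
  let ?h = "\<lambda>x. enn2ereal (F x) - enn2ereal (G x)"
  have FG: "AE x in M. F x < \<infinity> \<or> G x < \<infinity>"
    using fin
  proof
    assume "(\<integral>\<^sup>+x. F x \<partial>M) < \<infinity>"
    then have "AE x in M. F x \<noteq> \<infinity>" by (intro nn_integral_noteq_infinite) auto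
    then show ?thesis by eventually_elim (auto simp: less_top)
  next
    assume "(\<integral>\<^sup>+x. G x \<partial>M) < \<infinity>"
    then have "AE x in M. G x \<noteq> \<infinity>" by (intro nn_integral_noteq_infinite) auto
    then show ?thesis by eventually_elim (auto simp: less_top)
  qed
  have pos: "(\<integral>\<^sup>+x. e2ennreal (f x) \<partial>M) = (\<integral>\<^sup>+x. e2ennreal (?h x) \<partial>M)"
    by (rule nn_integral_cong_AE) (use f FG in eventually_elim, auto)
  have neg: "(\<integral>\<^sup>+x. e2ennreal (- f x) \<partial>M) = (\<integral>\<^sup>+x. e2ennreal (- ?h x) \<partial>M)"
    by (rule nn_integral_cong_AE) (use f FG in eventually_elim, auto)
  have "(\<integral>\<^sup>+x. e2ennreal (?h x) \<partial>M) + (\<integral>\<^sup>+x. G x \<partial>M) = (\<integral>\<^sup>+x. e2ennreal (?h x) + G x \<partial>M)"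
    by (rule nn_integral_add[symmetric]) auto
  also have "\<dots> = (\<integral>\<^sup>+x. e2ennreal (- ?h x) + F x \<partial>M)"
    by (rule nn_integral_cong_AE) (use FG in eventually_elim, use e2ennreal_diff_add(1) in blast)
  also have "\<dots> = (\<integral>\<^sup>+x. e2ennreal (- ?h x) \<partial>M) + (\<integral>\<^sup>+x. F x \<partial>M)"
    by (rule nn_integral_add) auto
  finally have eq: "(\<integral>\<^sup>+x. e2ennreal (?h x) \<partial>M) + (\<integral>\<^sup>+x. G x \<partial>M) =
      (\<integral>\<^sup>+x. e2ennreal (- ?h x) \<partial>M) + (\<integral>\<^sup>+x. F x \<partial>M)" .
  have le1: "(\<integral>\<^sup>+x. e2ennreal (?h x) \<partial>M) \<le> (\<integral>\<^sup>+x. F x \<partial>M)"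
    by (rule nn_integral_mono_AE) (use FG in eventually_elim, use e2ennreal_diff_add(2) in blast)
  have le2: "(\<integral>\<^sup>+x. e2ennreal (- ?h x) \<partial>M) \<le> (\<integral>\<^sup>+x. G x \<partial>M)"
    by (rule nn_integral_mono_AE) (use FG in eventually_elim, use e2ennreal_diff_add(3) in blast)
  show ?thesis
    unfolding ext_integral_def pos neg by (rule ereal_diff_eq_diff[OF eq le1 le2 fin])
qed

lemma infsum_eq_diff_nn_integral:
  fixes f :: "'a \<Rightarrow> real"
  assumes "f summable_on A"
  shows "(\<integral>\<^sup>+x. ennreal (f x) \<partial>count_space A) < \<infinity>"
    and "(\<integral>\<^sup>+x. ennreal (- f x) \<partial>count_space A) < \<infinity>"
    and "infsum f A = enn2real (\<integral>\<^sup>+x. ennreal (f x) \<partial>count_space A)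
                    - enn2real (\<integral>\<^sup>+x. ennreal (- f x) \<partial>count_space A)"
proof -
  have abs: "Infinite_Set_Sum.abs_summable_on f A"
    using assms unfolding abs_summable_equivalent[symmetric]
    by (rule iffD1[OF summable_on_iff_abs_summable_on_real])
  then have int: "integrable (count_space A) f"
    by (simp add: abs_summable_on_def)
  then show "(\<integral>\<^sup>+x. ennreal (f x) \<partial>count_space A) < \<infinity>"
    and "(\<integral>\<^sup>+x. ennreal (- f x) \<partial>count_space A) < \<infinity>"
    by (auto simp: real_integrable_def top.not_eq_extremum)
  show "infsum f A = enn2real (\<integral>\<^sup>+x. ennreal (f x) \<partial>count_space A)
                    - enn2real (\<integral>\<^sup>+x. ennreal (- f x) \<partial>count_space A)"
    using real_lebesgue_integral_def[OF int] infsetsum_infsum[OF abs] by (simp add: infsetsum_def)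
qed

section \<open>Disintegration along a discrete random variable\<close>

context prob_space
begin

lemma has_sum_prob_atoms:
  fixes Y :: "'a \<Rightarrow> 'b::countable"
  assumes Y: "\<And>y. {\<omega> \<in> space M. Y \<omega> = y} \<in> events"
    and P: "{\<omega> \<in> space M. P \<omega>} \<in> events"
  shows "((\<lambda>y. \<P>(\<omega> in M. P \<omega> \<and> Y \<omega> = y)) has_sum \<P>(\<omega> in M. P \<omega>)) UNIV"
proof -
  let ?B = "\<lambda>y. {\<omega> \<in> space M. P \<omega> \<and> Y \<omega> = y}"
  have B: "?B y \<in> events" for y
    using sets.Int[OF P Y[of y]] by (rule back_subst[of "\<lambda>A. A \<in> events"]) auto
  have "emeasure M (\<Union>y\<in>UNIV. ?B y) = (\<integral>\<^sup>+y. emeasure M (?B y) \<partial>count_space UNIV)"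
    using B by (intro emeasure_UN_countable) (auto simp: disjoint_family_on_def)
  also have "(\<Union>y\<in>UNIV. ?B y) = {\<omega> \<in> space M. P \<omega>}" by auto
  finally have eq: "(\<integral>\<^sup>+y. ennreal (prob (?B y)) \<partial>count_space UNIV) = ennreal (\<P>(\<omega> in M. P \<omega>))"
    by (simp add: emeasure_eq_measure)
  have "integrable (count_space UNIV) (\<lambda>y. prob (?B y))"
    by (rule integrableI_nonneg) (auto simp: eq)
  then have abs: "Infinite_Set_Sum.abs_summable_on (\<lambda>y. prob (?B y)) UNIV"
    by (simp add: abs_summable_on_def)
  have "infsum (\<lambda>y. prob (?B y)) UNIV = infsetsum (\<lambda>y. prob (?B y)) UNIV"
    using infsetsum_infsum[OF abs] by simp
  also have "\<dots> = \<P>(\<omega> in M. P \<omega>)"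
    by (subst infsetsum_conv_nn_integral) (auto simp: eq)
  finally have "infsum (\<lambda>y. prob (?B y)) UNIV = \<P>(\<omega> in M. P \<omega>)" .
  moreover have "(\<lambda>y. prob (?B y)) summable_on UNIV"
    using abs unfolding abs_summable_equivalent[symmetric]
    by (rule iffD2[OF summable_on_iff_abs_summable_on_real])
  ultimately show ?thesis by (simp add: has_sum_iff)
qed

text \<open>
  A coarsening argument: if the conditional probability of an event is the same constant on all
  atoms of positive probability that make up \<open>P\<close>, then it has this value given \<open>P\<close>.
\<close>

lemma prob_conj_eq_mult_if_atoms:
  fixes Y :: "'a \<Rightarrow> 'b::countable"
  assumes Y: "\<And>y. {\<omega> \<in> space M. Y \<omega> = y} \<in> events"
    and P: "{\<omega> \<in> space M. P \<omega>} \<in> events"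
    and Q: "{\<omega> \<in> space M. Q \<omega>} \<in> events"
    and det: "\<And>\<omega> \<omega>'. Y \<omega> = Y \<omega>' \<Longrightarrow> P \<omega> \<Longrightarrow> P \<omega>'"
    and c: "\<And>\<omega>. P \<omega> \<Longrightarrow> \<P>(\<omega>' in M. Y \<omega>' = Y \<omega>) > 0 \<Longrightarrow>
        \<P>(\<omega>' in M. Q \<omega>' \<bar> Y \<omega>' = Y \<omega>) = c"
  shows "\<P>(\<omega> in M. P \<omega> \<and> Q \<omega>) = \<P>(\<omega> in M. P \<omega>) * c"
proof -
  have PQ: "{\<omega> \<in> space M. P \<omega> \<and> Q \<omega>} \<in> events"
    using sets.Int[OF P Q] by (rule back_subst[of "\<lambda>A. A \<in> events"]) auto
  have *: "\<P>(\<omega> in M. (P \<omega> \<and> Q \<omega>) \<and> Y \<omega> = y) = \<P>(\<omega> in M. P \<omega> \<and> Y \<omega> = y) * c" for y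
  proof (cases "\<exists>\<omega>. P \<omega> \<and> Y \<omega> = y")
    case False
    then have none: "{\<omega> \<in> space M. (P \<omega> \<and> Q \<omega>) \<and> Y \<omega> = y} = {}" "{\<omega> \<in> space M. P \<omega> \<and> Y \<omega> = y} = {}"
      by auto
    show ?thesis unfolding none by simp
  next
    case True
    then obtain \<omega>0 where w: "P \<omega>0" "Y \<omega>0 = y" by auto
    have atom: "P \<omega>" if "Y \<omega> = y" for \<omega>
      by (rule det[OF _ w(1)]) (simp add: w(2) that)
    then have a: "{\<omega> \<in> space M. (P \<omega> \<and> Q \<omega>) \<and> Y \<omega> = y} = {\<omega> \<in> space M. Q \<omega> \<and> Y \<omega> = y}"
      and b: "{\<omega> \<in> space M. P \<omega> \<and> Y \<omega> = y} = {\<omega> \<in> space M. Y \<omega> = y}"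
      by auto
    show ?thesis
    proof (cases "\<P>(\<omega> in M. Y \<omega> = y) > 0")
      case True
      then show ?thesis
        unfolding a b using c[OF w(1)] w(2) by (simp add: cond_prob_def field_simps)
    next
      case False
      then have "\<P>(\<omega> in M. Y \<omega> = y) = 0" by (simp add: not_less measure_le_0_iff)
      moreover have "\<P>(\<omega> in M. Q \<omega> \<and> Y \<omega> = y) \<le> \<P>(\<omega> in M. Y \<omega> = y)"
        by (rule finite_measure_mono) (auto simp: Y)
      ultimately show ?thesis unfolding a b by (simp add: measure_le_0_iff)
    qed
  qed
  have "((\<lambda>y. \<P>(\<omega> in M. P \<omega> \<and> Y \<omega> = y) * c) has_sum \<P>(\<omega> in M. P \<omega> \<and> Q \<omega>)) UNIV"
    using has_sum_prob_atoms[OF Y PQ] unfolding * .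
  moreover have "((\<lambda>y. \<P>(\<omega> in M. P \<omega> \<and> Y \<omega> = y) * c) has_sum \<P>(\<omega> in M. P \<omega>) * c) UNIV"
    by (intro has_sum_cmult_left has_sum_prob_atoms Y P)
  ultimately show ?thesis by (rule has_sum_unique)
qed

end

section \<open>The path before the exit from the taboo set\<close>

lemma restricted_power_nonneg:
  assumes "\<And>i j. 0 \<le> A i j"
  shows "0 \<le> restricted_power H A k i j"
proof (induction k arbitrary: j)
  case (Suc k)
  then show ?case
    unfolding restricted_power.simps by (intro infsum_nonneg mult_nonneg_nonneg assms)
qed simp

lemma transition_matrix_nonneg: "0 \<le> transition_matrix p \<pi> i j"
  unfolding transition_matrix_def by (intro infsum_nonneg) simp

lemma green_kernel_nonneg: "0 \<le> green_kernel p \<pi> H i j"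
  unfolding green_kernel_def
  by (intro suminf_0_le) (simp add: restricted_power_nonneg transition_matrix_nonneg)

context markov_decision_process
begin

lemmas [measurable] = measurable_X measurable_U

text \<open>
  The model prescribes conditional probabilities given a full history only. An event that is
  determined by the history and fixes the current state is a countable union of such histories.
\<close>

lemma policy_given_past:
  assumes P: "{\<omega> \<in> space M. P \<omega>} \<in> events"
    and det: "\<And>\<omega> \<omega>'. (\<And>s. s \<le> t \<Longrightarrow> X s \<omega> = X s \<omega>') \<Longrightarrow> (\<And>s. s < t \<Longrightarrow> U s \<omega> = U s \<omega>') \<Longrightarrow>
        P \<omega> \<Longrightarrow> P \<omega>'"
    and state: "\<And>\<omega>. P \<omega> \<Longrightarrow> X t \<omega> = i"
  shows "\<P>(\<omega> in M. P \<omega> \<and> U t \<omega> = a) = \<P>(\<omega> in M. P \<omega>) * pmf (\<pi> i) a"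
proof -
  \<comment> \<open>The history is encoded by finite lists, so that its values form a countable type.\<close>
  define Y where "Y \<omega> = (map (\<lambda>s. X s \<omega>) [0..<Suc t], map (\<lambda>s. U s \<omega>) [0..<t])" for \<omega>
  have Y_eq: "Y \<omega> = Y \<omega>' \<longleftrightarrow> (\<forall>s\<le>t. X s \<omega> = X s \<omega>') \<and> (\<forall>s<t. U s \<omega> = U s \<omega>')" for \<omega> \<omega>'
    by (auto simp: Y_def less_Suc_eq_le simp del: upt_Suc)
  show ?thesis
  proof (rule prob_conj_eq_mult_if_atoms[where Y = Y])
    show "{\<omega> \<in> space M. Y \<omega> = y} \<in> events" for y
    proof (cases "\<exists>\<omega>0. Y \<omega>0 = y")
      case True
      then obtain \<omega>0 where "y = Y \<omega>0" by auto
      then show ?thesis unfolding \<open>y = Y \<omega>0\<close> Y_eq by measurable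
    qed auto
    show "{\<omega> \<in> space M. U t \<omega> = a} \<in> events" by measurable
    show "P \<omega>'" if "Y \<omega> = Y \<omega>'" "P \<omega>" for \<omega> \<omega>'
      using that det[of \<omega> \<omega>'] unfolding Y_eq by blast
    show "\<P>(\<omega>' in M. U t \<omega>' = a \<bar> Y \<omega>' = Y \<omega>) = pmf (\<pi> i) a"
      if "P \<omega>" "\<P>(\<omega>' in M. Y \<omega>' = Y \<omega>) > 0" for \<omega>
      using policy[of t "\<lambda>s. X s \<omega>" "\<lambda>s. U s \<omega>" a] that state unfolding Y_eq by simp
  qed (rule P)
qed

lemma transition_given_past:
  assumes P: "{\<omega> \<in> space M. P \<omega>} \<in> events"
    and det: "\<And>\<omega> \<omega>'. (\<And>s. s \<le> t \<Longrightarrow> X s \<omega> = X s \<omega>') \<Longrightarrow> (\<And>s. s \<le> t \<Longrightarrow> U s \<omega> = U s \<omega>') \<Longrightarrow>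
        P \<omega> \<Longrightarrow> P \<omega>'"
    and state: "\<And>\<omega>. P \<omega> \<Longrightarrow> X t \<omega> = i" "\<And>\<omega>. P \<omega> \<Longrightarrow> U t \<omega> = u"
  shows "\<P>(\<omega> in M. P \<omega> \<and> X (Suc t) \<omega> = j) = \<P>(\<omega> in M. P \<omega>) * pmf (p i u) j"
proof -
  define Y where "Y \<omega> = (map (\<lambda>s. X s \<omega>) [0..<Suc t], map (\<lambda>s. U s \<omega>) [0..<Suc t])" for \<omega>
  have Y_eq: "Y \<omega> = Y \<omega>' \<longleftrightarrow> (\<forall>s\<le>t. X s \<omega> = X s \<omega>' \<and> U s \<omega> = U s \<omega>')" for \<omega> \<omega>'
    by (auto simp: Y_def less_Suc_eq_le simp del: upt_Suc)
  show ?thesis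
  proof (rule prob_conj_eq_mult_if_atoms[where Y = Y])
    show "{\<omega> \<in> space M. Y \<omega> = y} \<in> events" for y
    proof (cases "\<exists>\<omega>0. Y \<omega>0 = y")
      case True
      then obtain \<omega>0 where "y = Y \<omega>0" by auto
      then show ?thesis unfolding \<open>y = Y \<omega>0\<close> Y_eq by measurable
    qed auto
    show "{\<omega> \<in> space M. X (Suc t) \<omega> = j} \<in> events" by measurable
    show "P \<omega>'" if "Y \<omega> = Y \<omega>'" "P \<omega>" for \<omega> \<omega>'
      using that det[of \<omega> \<omega>'] unfolding Y_eq by blast
    show "\<P>(\<omega>' in M. X (Suc t) \<omega>' = j \<bar> Y \<omega>' = Y \<omega>) = pmf (p i u) j"
      if "P \<omega>" "\<P>(\<omega>' in M. Y \<omega>' = Y \<omega>) > 0" for \<omega>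
      using transition[of t "\<lambda>s. X s \<omega>" "\<lambda>s. U s \<omega>" j] that state unfolding Y_eq by simp
  qed (rule P)
qed

text \<open>
  By induction on \<open>t\<close>, splitting the last step according to the state and the action before it:
  summing out the action turns \<open>p\<close> into the transition matrix, and only states in \<open>H\<close> contribute,
  because the path has not left \<open>H\<close>.
\<close>

lemma prob_stay_eq_restricted_power:
  assumes i: "i \<in> H" and j: "j \<in> H"
  shows "\<P>(\<omega> in M. X 0 \<omega> = i \<and> (\<forall>s\<le>t. X s \<omega> \<in> H) \<and> X t \<omega> = j) =
    \<P>(\<omega> in M. X 0 \<omega> = i) * restricted_power H (transition_matrix p \<pi>) t i j"
  using j
proof (induction t arbitrary: j)
  case 0
  show ?case
  proof (cases "i = j")
    case True
    then show ?thesis using i by (auto intro!: arg_cong[where f = prob])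
  next
    case False
    then have none: "{\<omega> \<in> space M. X 0 \<omega> = i \<and> (\<forall>s\<le>0. X s \<omega> \<in> H) \<and> X 0 \<omega> = j} = {}" by auto
    show ?thesis unfolding none using False by simp
  qed
next
  case (Suc t)
  let ?S = "\<lambda>\<omega>. X 0 \<omega> = i \<and> (\<forall>s\<le>t. X s \<omega> \<in> H)"
  let ?R = "restricted_power H (transition_matrix p \<pi>)"
  have step: "\<P>(\<omega> in M. (?S \<omega> \<and> X (Suc t) \<omega> = j) \<and> X t \<omega> = l) =
      \<P>(\<omega> in M. X 0 \<omega> = i) * (?R t i l * transition_matrix p \<pi> l j)" if l: "l \<in> H" for l
  proof -
    have "\<P>(\<omega> in M. ((?S \<omega> \<and> X (Suc t) \<omega> = j) \<and> X t \<omega> = l) \<and> U t \<omega> = u) =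
        \<P>(\<omega> in M. X 0 \<omega> = i) * ?R t i l * (pmf (\<pi> l) u * pmf (p l u) j)" for u
    proof -
      have "\<P>(\<omega> in M. ((?S \<omega> \<and> X (Suc t) \<omega> = j) \<and> X t \<omega> = l) \<and> U t \<omega> = u) =
          \<P>(\<omega> in M. ((?S \<omega> \<and> X t \<omega> = l) \<and> U t \<omega> = u) \<and> X (Suc t) \<omega> = j)"
        by (auto intro!: arg_cong[where f = prob])
      also have "\<dots> = \<P>(\<omega> in M. (?S \<omega> \<and> X t \<omega> = l) \<and> U t \<omega> = u) * pmf (p l u) j"
        by (rule transition_given_past) (measurable, auto)
      also have "\<P>(\<omega> in M. (?S \<omega> \<and> X t \<omega> = l) \<and> U t \<omega> = u) = \<P>(\<omega> in M. ?S \<omega> \<and> X t \<omega> = l) * pmf (\<pi> l) u"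
        by (rule policy_given_past) (measurable, auto)
      finally show ?thesis using Suc.IH[OF l] by (simp add: conj_ac)
    qed
    then have "((\<lambda>u. \<P>(\<omega> in M. X 0 \<omega> = i) * ?R t i l * (pmf (\<pi> l) u * pmf (p l u) j)) has_sum
        \<P>(\<omega> in M. (?S \<omega> \<and> X (Suc t) \<omega> = j) \<and> X t \<omega> = l)) UNIV"
      using has_sum_prob_atoms[of "U t" "\<lambda>\<omega>. (?S \<omega> \<and> X (Suc t) \<omega> = j) \<and> X t \<omega> = l"] by simp
    from infsumI[OF this] show ?thesis
      by (simp add: infsum_cmult_right' transition_matrix_def mult.assoc)
  qed
  have "((\<lambda>l. \<P>(\<omega> in M. (?S \<omega> \<and> X (Suc t) \<omega> = j) \<and> X t \<omega> = l)) has_sum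
      \<P>(\<omega> in M. ?S \<omega> \<and> X (Suc t) \<omega> = j)) UNIV"
    by (rule has_sum_prob_atoms) measurable
  also have "?this \<longleftrightarrow> ((\<lambda>l. \<P>(\<omega> in M. X 0 \<omega> = i) * (?R t i l * transition_matrix p \<pi> l j)) has_sum
      \<P>(\<omega> in M. ?S \<omega> \<and> X (Suc t) \<omega> = j)) H"
  proof (rule has_sum_cong_neutral)
    fix l assume "l \<in> UNIV - H"
    then have "{\<omega> \<in> space M. (?S \<omega> \<and> X (Suc t) \<omega> = j) \<and> X t \<omega> = l} = {}" by auto
    then show "\<P>(\<omega> in M. (?S \<omega> \<and> X (Suc t) \<omega> = j) \<and> X t \<omega> = l) = 0" by (metis measure_empty)
  qed (use step in auto)
  finally have "\<P>(\<omega> in M. ?S \<omega> \<and> X (Suc t) \<omega> = j) = \<P>(\<omega> in M. X 0 \<omega> = i) * ?R (Suc t) i j"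
    by (auto dest!: infsumI simp: infsum_cmult_right')
  moreover have "{\<omega> \<in> space M. X 0 \<omega> = i \<and> (\<forall>s\<le>Suc t. X s \<omega> \<in> H) \<and> X (Suc t) \<omega> = j} =
      {\<omega> \<in> space M. ?S \<omega> \<and> X (Suc t) \<omega> = j}"
    using Suc.prems by (auto simp: le_Suc_eq)
  ultimately show ?case by simp
qed

end

section \<open>The expected reward before the exit\<close>

text \<open>
  Only positive rewards are counted, since \<^const>\<open>ennreal\<close> sends negative numbers to \<open>0\<close>; the
  negative rewards are obtained from \<open>- \<rho>\<close>. If \<open>\<rho>\<close> vanishes on \<open>E = UNIV - H\<close>, it does not matter that
  the term at the hitting time of \<open>E\<close> is left out.
\<close>

definition positive_reward_before_exit ::
    "(nat \<Rightarrow> 'w \<Rightarrow> 'x) \<Rightarrow> (nat \<Rightarrow> 'w \<Rightarrow> 'u) \<Rightarrow> 'x set \<Rightarrow> ('u \<Rightarrow> 'x \<Rightarrow> real) \<Rightarrow> 'w \<Rightarrow> ennreal" where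
  "positive_reward_before_exit X U H \<rho> \<omega> =
     (\<Sum>t. if \<forall>s\<le>t. X s \<omega> \<in> H then ennreal (\<rho> (U t \<omega>) (X t \<omega>)) else 0)"

lemma enat_le_hitting_time_iff: "enat t \<le> hitting_time X E \<omega> \<longleftrightarrow> (\<forall>s<t. X s \<omega> \<notin> E)"
  unfolding hitting_time_def le_INF_iff by (auto; metis not_less)

text \<open>
  A path with finitely many visits to \<open>H\<close> leaves \<open>H\<close>, so that its reward is a finite sum. On a
  path that stays in \<open>H\<close> the two sides may differ: the real sum over infinitely many times is \<open>0\<close>
  by convention unless it converges absolutely.
\<close>

lemma reward_until_hitting_time:
  fixes \<rho> :: "'u \<Rightarrow> 'x \<Rightarrow> real"
  assumes fin: "finite {t. X t \<omega> \<in> H}" and H: "H = UNIV - E"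
    and E: "\<And>u e. e \<in> E \<Longrightarrow> \<rho> u e = 0"
  shows "ereal (\<Sum>\<^sub>\<infinity>t\<in>{t. enat t \<le> hitting_time X E \<omega>}. \<rho> (U t \<omega>) (X t \<omega>)) =
      enn2ereal (positive_reward_before_exit X U H \<rho> \<omega>) -
      enn2ereal (positive_reward_before_exit X U H (\<lambda>u x. - \<rho> u x) \<omega>)"
proof -
  define K where "K = {t. \<forall>s\<le>t. X s \<omega> \<in> H}"
  have finK: "finite K"
    by (rule finite_subset[OF _ fin]) (auto simp: K_def)
  have tot: "positive_reward_before_exit X U H r \<omega> = ennreal (\<Sum>t\<in>K. max 0 (r (U t \<omega>) (X t \<omega>)))"
    for r :: "'u \<Rightarrow> 'x \<Rightarrow> real"
  proof -
    have "positive_reward_before_exit X U H r \<omega> =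
        (\<Sum>t\<in>K. if \<forall>s\<le>t. X s \<omega> \<in> H then ennreal (r (U t \<omega>) (X t \<omega>)) else 0)"
      unfolding positive_reward_before_exit_def by (rule suminf_finite[OF finK]) (auto simp: K_def)
    also have "\<dots> = (\<Sum>t\<in>K. ennreal (max 0 (r (U t \<omega>) (X t \<omega>))))"
      by (rule sum.cong) (auto simp: K_def max_def ennreal_neg)
    also have "\<dots> = ennreal (\<Sum>t\<in>K. max 0 (r (U t \<omega>) (X t \<omega>)))"
      by (rule sum_ennreal) auto
    finally show ?thesis .
  qed
  have "(\<Sum>\<^sub>\<infinity>t\<in>{t. enat t \<le> hitting_time X E \<omega>}. \<rho> (U t \<omega>) (X t \<omega>)) =
      (\<Sum>\<^sub>\<infinity>t\<in>K. \<rho> (U t \<omega>) (X t \<omega>))"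
  proof (rule infsum_cong_neutral)
    fix t assume t: "t \<in> {t. enat t \<le> hitting_time X E \<omega>} - K"
    then obtain s where "s \<le> t" "X s \<omega> \<in> E" by (auto simp: K_def H)
    moreover have "\<not> s < t"
      using t \<open>X s \<omega> \<in> E\<close> by (auto simp: enat_le_hitting_time_iff)
    ultimately have "X t \<omega> \<in> E" by (simp add: le_less)
    then show "\<rho> (U t \<omega>) (X t \<omega>) = 0" by (rule E)
  qed (auto simp: K_def enat_le_hitting_time_iff H)
  also have "\<dots> = (\<Sum>t\<in>K. \<rho> (U t \<omega>) (X t \<omega>))"
    using finK by simp
  also have "\<dots> = (\<Sum>t\<in>K. max 0 (\<rho> (U t \<omega>) (X t \<omega>))) - (\<Sum>t\<in>K. max 0 (- \<rho> (U t \<omega>) (X t \<omega>)))"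
    by (subst sum_subtractf[symmetric], rule sum.cong) (auto simp: max_def)
  finally show ?thesis
    by (simp add: tot sum_nonneg)
qed

context markov_decision_process
begin

lemma measurable_reward_at_time:
  "(\<lambda>\<omega>. if \<forall>s\<le>t. X s \<omega> \<in> H then ennreal (\<rho> (U t \<omega>) (X t \<omega>)) else 0) \<in> borel_measurable M"
proof -
  have "(\<lambda>\<omega>. (U t \<omega>, X t \<omega>)) \<in> measurable M (count_space UNIV)"
    by measurable
  from measurable_compose[OF this, of "\<lambda>(u, x). ennreal (\<rho> u x)" borel]
  have [measurable]: "(\<lambda>\<omega>. ennreal (\<rho> (U t \<omega>) (X t \<omega>))) \<in> borel_measurable M"
    by simp
  show ?thesis by measurable
qed

lemma measurable_positive_reward_before_exit [measurable]:
  "positive_reward_before_exit X U H \<rho> \<in> borel_measurable M"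
  unfolding positive_reward_before_exit_def[abs_def]
  by (intro borel_measurable_suminf_order measurable_reward_at_time)

text \<open>
  By Tonelli the left hand side is the sum over times \<open>t\<close>, states \<open>j\<close> and actions \<open>u\<close> of
  \<open>\<P>(t < \<tau>, X\<^sub>t = j, U\<^sub>t = u)\<close> times the positive
  part of the reward, and this probability is \<open>Q(\<pi>)\<^sup>t\<^sub>i\<^sub>j \<pi>\<^sub>j\<^sub>u\<close>.
  Summing \<open>Q(\<pi>)\<^sup>t\<^sub>i\<^sub>j\<close> over \<open>t\<close> first gives the Green kernel, and summing over \<open>u\<close> the mean positive
  reward in \<open>j\<close>. As all terms are nonnegative, the identity holds in \<open>[0, \<infinity>]\<close>.
\<close>

lemma expected_positive_reward_before_exit:
  assumes i: "i \<in> H" and pos: "\<P>(\<omega> in M. X 0 \<omega> = i) > 0"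
  shows "(\<integral>\<^sup>+\<omega>. positive_reward_before_exit X U H \<rho> \<omega>
            \<partial>uniform_measure M {\<omega> \<in> space M. X 0 \<omega> = i}) =
    (\<integral>\<^sup>+j. e2ennreal (green_kernel p \<pi> H i j) *
            (\<integral>\<^sup>+u. ennreal (pmf (\<pi> j) u * \<rho> u j) \<partial>count_space UNIV) \<partial>count_space H)"
proof -
  let ?A = "{\<omega> \<in> space M. X 0 \<omega> = i}"
  let ?N = "uniform_measure M ?A"
  let ?R = "restricted_power H (transition_matrix p \<pi>)"
  let ?B = "\<lambda>t j u. {\<omega> \<in> space M. (\<forall>s\<le>t. X s \<omega> \<in> H) \<and> X t \<omega> = j \<and> U t \<omega> = u}"
  have A [measurable]: "?A \<in> events" by measurable
  have B [measurable]: "?B t j u \<in> events" for t j u by measurable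
  have occupation: "\<P>(\<omega> in M. X 0 \<omega> = i \<and> (\<forall>s\<le>t. X s \<omega> \<in> H) \<and> X t \<omega> = j) = prob ?A * ?R t i j"
    if "j \<in> H" for t j
    by (rule prob_stay_eq_restricted_power[OF i that])
  have R_nonneg: "0 \<le> ?R t i j" for t j
    by (intro restricted_power_nonneg transition_matrix_nonneg)
  have prob_B: "emeasure ?N (?B t j u) = ennreal (?R t i j) * ennreal (pmf (\<pi> j) u)"
    if j: "j \<in> H" for t j u
  proof -
    have "prob (?A \<inter> ?B t j u) =
        \<P>(\<omega> in M. (X 0 \<omega> = i \<and> (\<forall>s\<le>t. X s \<omega> \<in> H) \<and> X t \<omega> = j) \<and> U t \<omega> = u)"
      by (auto intro!: arg_cong[where f = prob])
    also have "\<dots> = \<P>(\<omega> in M. X 0 \<omega> = i \<and> (\<forall>s\<le>t. X s \<omega> \<in> H) \<and> X t \<omega> = j) * pmf (\<pi> j) u"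
      by (rule policy_given_past) (measurable, auto)
    also have "\<dots> = prob ?A * ?R t i j * pmf (\<pi> j) u"
      by (simp add: occupation[OF j])
    finally have "prob (?A \<inter> ?B t j u) / prob ?A = ?R t i j * pmf (\<pi> j) u"
      using pos by simp
    then show ?thesis
      using pos R_nonneg
      by (simp add: emeasure_uniform_measure emeasure_eq_measure divide_ennreal ennreal_mult)
  qed
  have time: "(\<integral>\<^sup>+\<omega>. (if \<forall>s\<le>t. X s \<omega> \<in> H then ennreal (\<rho> (U t \<omega>) (X t \<omega>)) else 0) \<partial>?N) =
      (\<integral>\<^sup>+j. ennreal (?R t i j) * (\<integral>\<^sup>+u. ennreal (pmf (\<pi> j) u * \<rho> u j) \<partial>count_space UNIV)
        \<partial>count_space H)" for t
  proof -
    have inner: "(\<integral>\<^sup>+u. ennreal (\<rho> u j) * indicator (?B t j u) \<omega> \<partial>count_space UNIV) =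
        (if (\<forall>s\<le>t. X s \<omega> \<in> H) \<and> X t \<omega> = j then ennreal (\<rho> (U t \<omega>) j) else 0)"
      if "\<omega> \<in> space M" for \<omega> j
      by (subst nn_integral_count_space'[of "{U t \<omega>}"]) (auto simp: that indicator_def)
    have [measurable]: "(\<lambda>\<omega>. \<integral>\<^sup>+u. ennreal (\<rho> u j) * indicator (?B t j u) \<omega> \<partial>count_space UNIV)
        \<in> borel_measurable M" for j
    proof (subst measurable_cong[OF inner])
      show "(\<lambda>\<omega>. if (\<forall>s\<le>t. X s \<omega> \<in> H) \<and> X t \<omega> = j then ennreal (\<rho> (U t \<omega>) j) else 0)
          \<in> borel_measurable M"
        using measurable_compose[OF measurable_U, of "\<lambda>u. ennreal (\<rho> u j)" borel t] by measurable
    qed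
    have "(\<integral>\<^sup>+\<omega>. (if \<forall>s\<le>t. X s \<omega> \<in> H then ennreal (\<rho> (U t \<omega>) (X t \<omega>)) else 0) \<partial>?N) =
        (\<integral>\<^sup>+\<omega>. (\<integral>\<^sup>+j. (\<integral>\<^sup>+u. ennreal (\<rho> u j) * indicator (?B t j u) \<omega> \<partial>count_space UNIV)
          \<partial>count_space H) \<partial>?N)"
    proof (rule nn_integral_cong)
      fix \<omega> assume "\<omega> \<in> space ?N"
      then have w: "\<omega> \<in> space M" by simp
      show "(if \<forall>s\<le>t. X s \<omega> \<in> H then ennreal (\<rho> (U t \<omega>) (X t \<omega>)) else 0) =
          (\<integral>\<^sup>+j. (\<integral>\<^sup>+u. ennreal (\<rho> u j) * indicator (?B t j u) \<omega> \<partial>count_space UNIV) \<partial>count_space H)"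
      proof (cases "\<forall>s\<le>t. X s \<omega> \<in> H")
        case True
        then show ?thesis
          unfolding inner[OF w] by (subst nn_integral_count_space'[of "{X t \<omega>}"]) auto
      next
        case False
        then show ?thesis unfolding inner[OF w] by (simp only: if_False simp_thms) simp
      qed
    qed
    also have "\<dots> = (\<integral>\<^sup>+j. (\<integral>\<^sup>+\<omega>. (\<integral>\<^sup>+u. ennreal (\<rho> u j) * indicator (?B t j u) \<omega> \<partial>count_space UNIV)
          \<partial>?N) \<partial>count_space H)"
      by (rule nn_integral_count_space_nn_integral) auto
    also have "\<dots> = (\<integral>\<^sup>+j. (\<integral>\<^sup>+u. (\<integral>\<^sup>+\<omega>. ennreal (\<rho> u j) * indicator (?B t j u) \<omega> \<partial>?N)
          \<partial>count_space UNIV) \<partial>count_space H)"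
      by (intro nn_integral_cong nn_integral_count_space_nn_integral) auto
    also have "\<dots> = (\<integral>\<^sup>+j. (\<integral>\<^sup>+u. ennreal (?R t i j) * ennreal (pmf (\<pi> j) u * \<rho> u j)
          \<partial>count_space UNIV) \<partial>count_space H)"
    proof (intro nn_integral_cong)
      fix j u assume "j \<in> space (count_space H)"
      then have j: "j \<in> H" by simp
      have "(\<integral>\<^sup>+\<omega>. ennreal (\<rho> u j) * indicator (?B t j u) \<omega> \<partial>?N) = ennreal (\<rho> u j) * emeasure ?N (?B t j u)"
        by (rule nn_integral_cmult_indicator) simp
      also have "\<dots> = ennreal (?R t i j) * (ennreal (pmf (\<pi> j) u) * ennreal (\<rho> u j))"
        unfolding prob_B[OF j] by (simp only: mult_ac)
      also have "\<dots> = ennreal (?R t i j) * ennreal (pmf (\<pi> j) u * \<rho> u j)"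
        by (simp add: ennreal_mult')
      finally show "(\<integral>\<^sup>+\<omega>. ennreal (\<rho> u j) * indicator (?B t j u) \<omega> \<partial>?N) =
          ennreal (?R t i j) * ennreal (pmf (\<pi> j) u * \<rho> u j)" .
    qed
    also have "\<dots> = (\<integral>\<^sup>+j. ennreal (?R t i j) * (\<integral>\<^sup>+u. ennreal (pmf (\<pi> j) u * \<rho> u j) \<partial>count_space UNIV)
        \<partial>count_space H)"
      by (intro nn_integral_cong nn_integral_cmult) auto
    finally show ?thesis .
  qed
  have green: "e2ennreal (green_kernel p \<pi> H i j) = (\<Sum>t. ennreal (?R t i j))" for j
  proof -
    have "green_kernel p \<pi> H i j = (\<Sum>t. enn2ereal (ennreal (?R t i j)))"
      using R_nonneg by (simp add: green_kernel_def)
    then show ?thesis by simp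
  qed
  have "(\<integral>\<^sup>+\<omega>. positive_reward_before_exit X U H \<rho> \<omega> \<partial>?N) =
      (\<Sum>t. \<integral>\<^sup>+\<omega>. (if \<forall>s\<le>t. X s \<omega> \<in> H then ennreal (\<rho> (U t \<omega>) (X t \<omega>)) else 0) \<partial>?N)"
    unfolding positive_reward_before_exit_def
    by (rule nn_integral_suminf) (simp add: measurable_reward_at_time)
  also have "\<dots> = (\<integral>\<^sup>+j. (\<Sum>t. ennreal (?R t i j) *
      (\<integral>\<^sup>+u. ennreal (pmf (\<pi> j) u * \<rho> u j) \<partial>count_space UNIV)) \<partial>count_space H)"
    unfolding time by (rule nn_integral_suminf[symmetric]) simp
  also have "\<dots> = (\<integral>\<^sup>+j. e2ennreal (green_kernel p \<pi> H i j) *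
      (\<integral>\<^sup>+u. ennreal (pmf (\<pi> j) u * \<rho> u j) \<partial>count_space UNIV) \<partial>count_space H)"
    by (intro nn_integral_cong) (simp add: green)
  finally show ?thesis .
qed

lemma AE_finitely_many_visits:
  assumes transient: "\<P>(\<omega> in M. (\<exists>\<^sub>\<infinity>t. X t \<omega> \<in> H) \<bar> X 0 \<omega> \<in> H) = 0"
    and i: "i \<in> H" and pos: "\<P>(\<omega> in M. X 0 \<omega> = i) > 0"
  shows "AE \<omega> in uniform_measure M {\<omega> \<in> space M. X 0 \<omega> = i}. finite {t. X t \<omega> \<in> H}"
proof -
  have "\<P>(\<omega> in M. X 0 \<omega> = i) \<le> \<P>(\<omega> in M. X 0 \<omega> \<in> H)"
    using i by (intro finite_measure_mono) auto
  with pos transient have "\<P>(\<omega> in M. (\<exists>\<^sub>\<infinity>t. X t \<omega> \<in> H) \<and> X 0 \<omega> \<in> H) = 0"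
    by (simp add: cond_prob_def)
  moreover have "{\<omega> \<in> space M. (\<exists>\<^sub>\<infinity>t. X t \<omega> \<in> H) \<and> X 0 \<omega> \<in> H} \<in> events"
    unfolding INFM_nat_le by measurable
  ultimately have "AE \<omega> in M. \<not> ((\<exists>\<^sub>\<infinity>t. X t \<omega> \<in> H) \<and> X 0 \<omega> \<in> H)"
    by (simp only: prob_Collect_eq_0)
  then show ?thesis
    by (intro AE_uniform_measureI, measurable, eventually_elim)
       (use i in \<open>auto simp: frequently_cofinite\<close>)
qed

text \<open>
  Transience makes the hitting time finite almost surely, so that the reward is almost surely the
  difference of the sums of its positive and of its negative terms.
\<close>

lemma cost_function_eq_diff:
  assumes transient: "\<P>(\<omega> in M. (\<exists>\<^sub>\<infinity>t. X t \<omega> \<in> H) \<bar> X 0 \<omega> \<in> H) = 0"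
    and H: "H = UNIV - E" and E: "\<And>u e. e \<in> E \<Longrightarrow> \<rho> u e = 0"
    and i: "i \<in> H" and pos: "\<P>(\<omega> in M. X 0 \<omega> = i) > 0"
    and fin: "(\<integral>\<^sup>+\<omega>. positive_reward_before_exit X U H \<rho> \<omega>
                \<partial>uniform_measure M {\<omega> \<in> space M. X 0 \<omega> = i}) < \<infinity> \<or>
              (\<integral>\<^sup>+\<omega>. positive_reward_before_exit X U H (\<lambda>u x. - \<rho> u x) \<omega>
                \<partial>uniform_measure M {\<omega> \<in> space M. X 0 \<omega> = i}) < \<infinity>"
  shows "cost_function M X U E \<rho> i =
    enn2ereal (\<integral>\<^sup>+\<omega>. positive_reward_before_exit X U H \<rho> \<omega>
      \<partial>uniform_measure M {\<omega> \<in> space M. X 0 \<omega> = i}) -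
    enn2ereal (\<integral>\<^sup>+\<omega>. positive_reward_before_exit X U H (\<lambda>u x. - \<rho> u x) \<omega>
      \<partial>uniform_measure M {\<omega> \<in> space M. X 0 \<omega> = i})"
  unfolding cost_function_def
proof (rule ext_integral_diff[OF _ _ _ fin])
  let ?N = "uniform_measure M {\<omega> \<in> space M. X 0 \<omega> = i}"
  show "AE \<omega> in ?N.
      positive_reward_before_exit X U H \<rho> \<omega> < \<infinity> \<or>
      positive_reward_before_exit X U H (\<lambda>u x. - \<rho> u x) \<omega> < \<infinity> \<longrightarrow>
      ereal (\<Sum>\<^sub>\<infinity>t\<in>{t. enat t \<le> hitting_time X E \<omega>}. \<rho> (U t \<omega>) (X t \<omega>)) =
      enn2ereal (positive_reward_before_exit X U H \<rho> \<omega>) -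
      enn2ereal (positive_reward_before_exit X U H (\<lambda>u x. - \<rho> u x) \<omega>)"
    using AE_finitely_many_visits[OF transient i pos]
  proof eventually_elim
    case (elim \<omega>)
    show ?case
      by (rule impI, rule reward_until_hitting_time[where X = X, OF elim H]) (erule E)
  qed
qed simp_all

lemma cost_function_nonneg_reward:
  assumes transient: "\<P>(\<omega> in M. (\<exists>\<^sub>\<infinity>t. X t \<omega> \<in> H) \<bar> X 0 \<omega> \<in> H) = 0"
    and H: "H = UNIV - E" and E: "\<And>u e. e \<in> E \<Longrightarrow> \<rho> u e = 0"
    and i: "i \<in> H" and pos: "\<P>(\<omega> in M. X 0 \<omega> = i) > 0"
  shows "cost_function M X U E (\<lambda>u x. max 0 (\<rho> u x)) i =
    enn2ereal (\<integral>\<^sup>+\<omega>. positive_reward_before_exit X U H \<rho> \<omega>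
      \<partial>uniform_measure M {\<omega> \<in> space M. X 0 \<omega> = i})"
proof -
  have max_0: "ennreal (max 0 r) = ennreal r" for r
    by (simp add: max_def ennreal_neg)
  have same: "positive_reward_before_exit X U H (\<lambda>u x. max 0 (\<rho> u x)) = positive_reward_before_exit X U H \<rho>"
    unfolding positive_reward_before_exit_def[abs_def] max_0 ..
  have none: "positive_reward_before_exit X U H (\<lambda>u x. - max 0 (\<rho> u x)) = (\<lambda>\<omega>. 0)"
    by (auto simp: positive_reward_before_exit_def fun_eq_iff ennreal_neg cong: if_cong)
  show ?thesis
    using cost_function_eq_diff[OF transient H _ i pos, of "\<lambda>u x. max 0 (\<rho> u x)"] E
    by (simp add: same none zero_ennreal.rep_eq)
qed

lemma cost_function_on_target:
  assumes e: "e \<in> E" and E: "\<And>u. \<rho> u e = 0"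
  shows "cost_function M X U E \<rho> e = 0"
proof -
  let ?N = "uniform_measure M {\<omega> \<in> space M. X 0 \<omega> = e}"
  have "AE \<omega> in ?N. X 0 \<omega> = e"
    by (rule AE_uniform_measureI) auto
  then have zero: "AE \<omega> in ?N. (\<Sum>\<^sub>\<infinity>t\<in>{t. enat t \<le> hitting_time X E \<omega>}. \<rho> (U t \<omega>) (X t \<omega>)) = 0"
  proof eventually_elim
    case (elim \<omega>)
    then have "{t. enat t \<le> hitting_time X E \<omega>} = {0}"
      using e by (auto simp: enat_le_hitting_time_iff)
    then show ?case using elim E by simp
  qed
  have "(\<integral>\<^sup>+\<omega>. ennreal (\<Sum>\<^sub>\<infinity>t\<in>{t. enat t \<le> hitting_time X E \<omega>}. \<rho> (U t \<omega>) (X t \<omega>)) \<partial>?N) = (\<integral>\<^sup>+\<omega>. 0 \<partial>?N)"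
    by (rule nn_integral_cong_AE) (use zero in eventually_elim, simp)
  moreover have "(\<integral>\<^sup>+\<omega>. ennreal (- (\<Sum>\<^sub>\<infinity>t\<in>{t. enat t \<le> hitting_time X E \<omega>}. \<rho> (U t \<omega>) (X t \<omega>))) \<partial>?N) = (\<integral>\<^sup>+\<omega>. 0 \<partial>?N)"
    by (rule nn_integral_cong_AE) (use zero in eventually_elim, simp)
  ultimately show ?thesis
    by (simp add: cost_function_def ext_integral_def)
qed

end

section \<open>The cost function and the Green kernel\<close>

text \<open>
  An entry \<open>A i j\<close> may be infinite. If the sum with the positive parts \<open>P\<close> or the sum with the
  negative parts \<open>N\<close> is finite, then \<open>P j = 0\<close> or \<open>N j = 0\<close> at such a state, so that the
  distributive law holds there as well.
\<close>

lemma matrix_vector_eq_diff: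
  fixes A :: "'x \<Rightarrow> 'x \<Rightarrow> ereal" and P N :: "'x \<Rightarrow> ennreal"
  assumes A: "\<And>j. j \<in> H \<Longrightarrow> 0 \<le> A i j"
    and v: "\<And>j. j \<in> H \<Longrightarrow> v j = enn2real (P j) - enn2real (N j)"
    and PN: "\<And>j. j \<in> H \<Longrightarrow> P j < \<infinity>" "\<And>j. j \<in> H \<Longrightarrow> N j < \<infinity>"
    and fin: "(\<integral>\<^sup>+j. e2ennreal (A i j) * P j \<partial>count_space H) < \<infinity> \<or>
              (\<integral>\<^sup>+j. e2ennreal (A i j) * N j \<partial>count_space H) < \<infinity>"
  shows "matrix_vector H A v i =
    enn2ereal (\<integral>\<^sup>+j. e2ennreal (A i j) * P j \<partial>count_space H) -
    enn2ereal (\<integral>\<^sup>+j. e2ennreal (A i j) * N j \<partial>count_space H)"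
  unfolding matrix_vector_def
proof (rule ext_integral_diff[OF _ _ _ fin])
  have *: "a * ereal (b - c) = enn2ereal (e2ennreal a * ennreal b) - enn2ereal (e2ennreal a * ennreal c)"
    if "0 \<le> a" "0 \<le> b" "0 \<le> c" "e2ennreal a * ennreal b < \<infinity> \<or> e2ennreal a * ennreal c < \<infinity>"
    for a :: ereal and b c :: real
  proof (cases a)
    case (real r)
    then show ?thesis
      using that by (simp add: ennreal_mult[symmetric] algebra_simps)
  next
    case PInf
    then have "b = 0 \<or> c = 0"
      using that by (auto simp: ennreal_top_mult split: if_splits)
    then show ?thesis
      using PInf that by (auto simp: ennreal_top_mult zero_ennreal.rep_eq)
  qed (use that in auto)
  show "AE j in count_space H. e2ennreal (A i j) * P j < \<infinity> \<or> e2ennreal (A i j) * N j < \<infinity> \<longrightarrow>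
      A i j * ereal (v j) = enn2ereal (e2ennreal (A i j) * P j) - enn2ereal (e2ennreal (A i j) * N j)"
  proof (rule AE_I2, intro impI)
    fix j assume "j \<in> space (count_space H)"
      and f: "e2ennreal (A i j) * P j < \<infinity> \<or> e2ennreal (A i j) * N j < \<infinity>"
    then have j: "j \<in> H" by simp
    show "A i j * ereal (v j) = enn2ereal (e2ennreal (A i j) * P j) - enn2ereal (e2ennreal (A i j) * N j)"
      using *[OF A[OF j], of "enn2real (P j)" "enn2real (N j)"] f PN[OF j]
      by (simp add: v[OF j] ennreal_enn2real)
  qed
qed simp_all

theorem proposition1:
  fixes M :: "'w measure"
    and p :: "'x::countable \<Rightarrow> 'u::countable \<Rightarrow> 'x pmf"
    and \<pi> :: "'x \<Rightarrow> 'u pmf"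
    and X :: "nat \<Rightarrow> 'w \<Rightarrow> 'x"
    and U :: "nat \<Rightarrow> 'w \<Rightarrow> 'u"
    and \<rho> :: "'u \<Rightarrow> 'x \<Rightarrow> real"
    and E H :: "'x set"
  assumes "markov_decision_process M p \<pi> X U"
    and "H = UNIV - E"
    and "\<P>(\<omega> in M. (\<exists>\<^sub>\<infinity>t. X t \<omega> \<in> H) \<bar> X 0 \<omega> \<in> H) = 0"
    and "\<And>u e. e \<in> E \<Longrightarrow> \<rho> u e = 0"
    and "\<And>i. i \<in> H \<Longrightarrow> (\<lambda>u. pmf (\<pi> i) u * \<rho> u i) summable_on UNIV"
  shows "(\<forall>i\<in>H. \<P>(\<omega> in M. X 0 \<omega> = i) > 0 \<longrightarrow> cost_well_defined M X U E \<rho> i \<longrightarrow>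
            cost_function M X U E \<rho> i =
              matrix_vector H (green_kernel p \<pi> H) (policy_reward \<pi> \<rho>) i) \<and>
         (\<forall>e\<in>E. \<P>(\<omega> in M. X 0 \<omega> = e) > 0 \<longrightarrow> cost_function M X U E \<rho> e = 0)"
proof (intro conjI ballI impI)
  interpret markov_decision_process M p \<pi> X U by fact
  show "cost_function M X U E \<rho> e = 0" if "e \<in> E" for e
    by (rule cost_function_on_target[OF that]) (rule assms(4)[OF that])
  fix i
  assume i: "i \<in> H" and pos: "\<P>(\<omega> in M. X 0 \<omega> = i) > 0"
    and wd: "cost_well_defined M X U E \<rho> i"
  let ?N = "uniform_measure M {\<omega> \<in> space M. X 0 \<omega> = i}"
  let ?V = "\<lambda>\<rho>. \<integral>\<^sup>+\<omega>. positive_reward_before_exit X U H \<rho> \<omega> \<partial>?N"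
  let ?r = "\<lambda>\<rho> j. \<integral>\<^sup>+u. ennreal (pmf (\<pi> j) u * \<rho> u j) \<partial>count_space UNIV"
  have V: "?V \<rho> = (\<integral>\<^sup>+j. e2ennreal (green_kernel p \<pi> H i j) * ?r \<rho> j \<partial>count_space H)" for \<rho>
    by (rule expected_positive_reward_before_exit[OF i pos])
  have fin: "?V \<rho> < \<infinity> \<or> ?V (\<lambda>u x. - \<rho> u x) < \<infinity>"
    using wd cost_function_nonneg_reward[OF assms(3,2) _ i pos, of \<rho>]
      cost_function_nonneg_reward[OF assms(3,2) _ i pos, of "\<lambda>u x. - \<rho> u x"] assms(4)
    by (simp add: cost_well_defined_def less_top)
  have "cost_function M X U E \<rho> i = enn2ereal (?V \<rho>) - enn2ereal (?V (\<lambda>u x. - \<rho> u x))"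
    by (rule cost_function_eq_diff[OF assms(3,2) _ i pos fin]) (rule assms(4))
  also have "\<dots> = matrix_vector H (green_kernel p \<pi> H) (policy_reward \<pi> \<rho>) i"
    unfolding V
  proof (rule matrix_vector_eq_diff[symmetric])
    fix j assume j: "j \<in> H"
    show "0 \<le> green_kernel p \<pi> H i j"
      by (rule green_kernel_nonneg)
    show "?r \<rho> j < \<infinity>" "?r (\<lambda>u x. - \<rho> u x) j < \<infinity>"
      "policy_reward \<pi> \<rho> j = enn2real (?r \<rho> j) - enn2real (?r (\<lambda>u x. - \<rho> u x) j)"
      using infsum_eq_diff_nn_integral[OF assms(5)[OF j]] by (simp_all add: policy_reward_def)
  qed (use fin in \<open>simp add: V\<close>)
  finally show "cost_function M X U E \<rho> i =
      matrix_vector H (green_kernel p \<pi> H) (policy_reward \<pi> \<rho>) i" .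
qed

end
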